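(* There exist $p\in\mathbb{N}$, a $p\times p$ correlation matrix $C$, $\lambda\ge 0$ and $\alpha<1$ such that the problem of minimizing \[ -\log\det(R)-2(1-\alpha)\log\det(D) +\operatorname{tr}( C DRD)+ \lambda \|R\|_{1,\mathrm{off}} \] over $(R,D)\in\mathrm{S}_{++}^{(1)}\times\mathrm{Diag}_+$ has more than one (global) minimizer.
   Context: $\mathrm{S}_{++}^{(1)}$ is the set of real symmetric positive definite $p\times p$ matrices with unit diagonal; $\mathrm{Diag}_+$ is the set of $p\times p$ diagonal matrices with strictly positive diagonal entries. A correlation matrix is a symmetric positive semidefinite matrix with unit diagonal. $\|R\|_{1,\mathrm{off}}=\sum_{i\ne j}|R_{ij}|$. *)

theory Defs
  imports Complex_Main "Jordan_Normal_Form.Determinant"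
begin

definition real_symmetric_mats :: "nat \<Rightarrow> real mat set" where
  "real_symmetric_mats p = {A \<in> carrier_mat p p. transpose_mat A = A}"

definition pos_semidef :: "real mat \<Rightarrow> bool" where
  "pos_semidef A \<longleftrightarrow> (\<forall>x \<in> carrier_vec (dim_row A). 0 \<le> x \<bullet> (A *\<^sub>v x))"

definition pos_def :: "real mat \<Rightarrow> bool" where
  "pos_def A \<longleftrightarrow>
     (\<forall>x \<in> carrier_vec (dim_row A). x \<noteq> 0\<^sub>v (dim_row A) \<longrightarrow> 0 < x \<bullet> (A *\<^sub>v x))"

definition unit_diagonal :: "real mat \<Rightarrow> bool" where
  "unit_diagonal A \<longleftrightarrow> (\<forall>i < dim_row A. A $$ (i, i) = 1)"

definition correlation_mats :: "nat \<Rightarrow> real mat set" where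
  "correlation_mats p = {C \<in> real_symmetric_mats p. pos_semidef C \<and> unit_diagonal C}"

definition pos_def_unit_diag_mats :: "nat \<Rightarrow> real mat set" where
  "pos_def_unit_diag_mats p = {R \<in> real_symmetric_mats p. pos_def R \<and> unit_diagonal R}"

definition pos_diag_mats :: "nat \<Rightarrow> real mat set" where
  "pos_diag_mats p = {D \<in> carrier_mat p p. diagonal_mat D \<and> (\<forall>i < p. 0 < D $$ (i, i))}"

definition mat_trace :: "real mat \<Rightarrow> real" where
  "mat_trace A = (\<Sum>i < dim_row A. A $$ (i, i))"

definition off_diag_l1_norm :: "real mat \<Rightarrow> real" where
  "off_diag_l1_norm A =
     (\<Sum>(i, j) \<in> {(i, j). i < dim_row A \<and> j < dim_col A \<and> i \<noteq> j}. \<bar>A $$ (i, j)\<bar>)"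

definition objective :: "real mat \<Rightarrow> real \<Rightarrow> real \<Rightarrow> real mat \<times> real mat \<Rightarrow> real" where
  "objective C lam \<alpha> = (\<lambda>(R, D).
     - ln (det R) - 2 * (1 - \<alpha>) * ln (det D) + mat_trace (C * D * R * D)
       + lam * off_diag_l1_norm R)"

definition minimizers :: "nat \<Rightarrow> real mat \<Rightarrow> real \<Rightarrow> real \<Rightarrow> (real mat \<times> real mat) set" where
  "minimizers p C lam \<alpha> =
     {RD. is_arg_min (objective C lam \<alpha>)
            (\<lambda>RD. RD \<in> pos_def_unit_diag_mats p \<times> pos_diag_mats p) RD}"

end

theory Submission
  imports Defs
begin

text \<open>For \<open>p = 2\<close> minimizing over \<open>D\<close> leaves, with \<open>\<alpha> = 1 - a\<close> and up to a constant, the function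
  \<open>2 a ln (1 + c r) - ln (1 - r\<^sup>2) + 2 \<lambda> \<bar>r\<bar>\<close> of the off-diagonal entry \<open>r\<close> of \<open>R\<close>. If \<open>a c\<^sup>2 > 1\<close>,
  then its part without the penalty is concave near \<open>0\<close> but tends to infinity at \<open>r = -1\<close>. For
  the least \<open>\<lambda>\<close> that makes \<open>r = 0\<close> a global minimizer, a second minimizer with \<open>r < 0\<close> therefore
  ties with it. The proof uses \<open>c = 2/3\<close> and \<open>a = 9\<close>.\<close>

section \<open>Coordinates on the feasible set for \<open>p = 2\<close>\<close>

definition corr2 :: "real \<Rightarrow> real mat" where
  "corr2 r = mat 2 2 (\<lambda>(i, j). if i = j then 1 else r)"

definition diag2 :: "real \<Rightarrow> real \<Rightarrow> real mat" where
  "diag2 d e = mat 2 2 (\<lambda>(i, j). if i = j then (if i = 0 then d else e) else 0)"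

lemma corr2_quadratic_form:
  assumes "x \<in> carrier_vec 2"
  shows "x \<bullet> (corr2 r *\<^sub>v x) = (x $ 0)\<^sup>2 + 2 * r * x $ 0 * x $ 1 + (x $ 1)\<^sup>2"
  using assms
  by (simp add: corr2_def scalar_prod_def numeral_2_eq_2 power2_eq_square algebra_simps)

lemma corr2_symmetric: "corr2 r \<in> real_symmetric_mats 2"
  by (auto simp: real_symmetric_mats_def corr2_def)

lemma corr2_unit_diagonal: "unit_diagonal (corr2 r)"
  by (simp add: unit_diagonal_def corr2_def)

lemma corr2_pos_def:
  assumes "\<bar>r\<bar> < 1"
  shows "pos_def (corr2 r)"
  unfolding pos_def_def
proof (intro ballI impI)
  fix x :: "real vec"
  assume "x \<in> carrier_vec (dim_row (corr2 r))" and x0: "x \<noteq> 0\<^sub>v (dim_row (corr2 r))"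
  then have x: "x \<in> carrier_vec 2" by (simp add: corr2_def)
  have nz: "x $ 0 \<noteq> 0 \<or> x $ 1 \<noteq> 0"
  proof (rule ccontr)
    assume "\<not> ?thesis"
    then have "x = 0\<^sub>v 2" using x by (intro eq_vecI) (auto simp: less_2_cases_iff)
    then show False using x0 by (simp add: corr2_def)
  qed
  have r2: "1 - r\<^sup>2 > 0" using assms by (simp add: abs_square_less_1)
  have eq: "x \<bullet> (corr2 r *\<^sub>v x) = (x $ 0 + r * x $ 1)\<^sup>2 + (1 - r\<^sup>2) * (x $ 1)\<^sup>2"
    unfolding corr2_quadratic_form[OF x] by (simp add: power2_eq_square algebra_simps)
  show "0 < x \<bullet> (corr2 r *\<^sub>v x)"
  proof (cases "x $ 1 = 0")
    case True
    then show ?thesis using nz unfolding eq by simp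
  next
    case False
    then have "(1 - r\<^sup>2) * (x $ 1)\<^sup>2 > 0" using r2 by simp
    then show ?thesis unfolding eq by (simp add: add_nonneg_pos)
  qed
qed

lemma corr2_in_pos_def_unit_diag_mats:
  "\<bar>r\<bar> < 1 \<Longrightarrow> corr2 r \<in> pos_def_unit_diag_mats 2"
  by (simp add: pos_def_unit_diag_mats_def corr2_symmetric corr2_unit_diagonal corr2_pos_def)

lemma corr2_in_correlation_mats:
  assumes "\<bar>r\<bar> < 1"
  shows "corr2 r \<in> correlation_mats 2"
proof -
  have "pos_semidef (corr2 r)"
    unfolding pos_semidef_def
  proof
    fix x :: "real vec" assume x: "x \<in> carrier_vec (dim_row (corr2 r))"
    show "0 \<le> x \<bullet> (corr2 r *\<^sub>v x)"
    proof (cases "x = 0\<^sub>v (dim_row (corr2 r))")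
      case True
      then show ?thesis using corr2_quadratic_form[of x r] by (simp add: corr2_def)
    next
      case False
      then show ?thesis using corr2_pos_def[OF assms] x by (auto simp: pos_def_def less_imp_le)
    qed
  qed
  then show ?thesis by (simp add: correlation_mats_def corr2_symmetric corr2_unit_diagonal)
qed

lemma pos_def_unit_diag_mats_2E:
  assumes "R \<in> pos_def_unit_diag_mats 2"
  obtains r where "R = corr2 r" "\<bar>r\<bar> < 1"
proof -
  define r where "r = R $$ (0, 1)"
  have R: "R \<in> carrier_mat 2 2" "transpose_mat R = R" "pos_def R" "unit_diagonal R"
    using assms by (auto simp: pos_def_unit_diag_mats_def real_symmetric_mats_def)
  have "R $$ (1, 0) = transpose_mat R $$ (0, 1)" using R(1) by simp
  then have "R $$ (1, 0) = r" using R(2) by (simp add: r_def)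
  then have eq: "R = corr2 r"
    using R(1,4) by (intro eq_matI) (auto simp: corr2_def r_def unit_diagonal_def less_2_cases_iff)
  \<comment> \<open>At (-r, 1) the quadratic form equals \<open>1 - r^2\<close>, so positivity on
    this single vector already bounds \<open>r\<close>.\<close>
  define x where "x = vec 2 (\<lambda>i. if i = 0 then - r else (1::real))"
  have x: "x \<in> carrier_vec 2" by (simp add: x_def)
  have "x $ 1 \<noteq> 0\<^sub>v 2 $ 1" by (simp add: x_def)
  then have "x \<noteq> 0\<^sub>v 2" by metis
  then have "0 < x \<bullet> (corr2 r *\<^sub>v x)"
    using R(3) x unfolding eq by (simp add: pos_def_def corr2_def)
  then have "r\<^sup>2 < 1"
    unfolding corr2_quadratic_form[OF x] by (simp add: x_def power2_eq_square)
  then have "\<bar>r\<bar> < 1" by (simp add: abs_square_less_1)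
  with eq show ?thesis by (rule that)
qed

lemma diag2_in_pos_diag_mats: "0 < d \<Longrightarrow> 0 < e \<Longrightarrow> diag2 d e \<in> pos_diag_mats 2"
  by (simp add: pos_diag_mats_def diag2_def diagonal_mat_def)

lemma pos_diag_mats_2E:
  assumes "D \<in> pos_diag_mats 2"
  obtains d e where "D = diag2 d e" "0 < d" "0 < e"
proof
  show "D = diag2 (D $$ (0, 0)) (D $$ (1, 1))"
    using assms
    by (intro eq_matI) (auto simp: pos_diag_mats_def diagonal_mat_def diag2_def less_2_cases_iff)
  show "0 < D $$ (0, 0)" "0 < D $$ (1, 1)"
    using assms by (auto simp: pos_diag_mats_def)
qed

section \<open>The objective in the coordinates r, d, e\<close>

lemma det_mat_2:
  fixes A :: "'a :: comm_ring_1 mat"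
  assumes "A \<in> carrier_mat 2 2"
  shows "det A = A $$ (0, 0) * A $$ (1, 1) - A $$ (0, 1) * A $$ (1, 0)"
proof -
  have single: "det (mat_delete A i j) = mat_delete A i j $$ (0, 0)" if "i < 2" "j < 2" for i j
    using assms mat_delete_carrier[of A 2 2 i j] by (intro det_single) simp
  have "det A = (\<Sum>j<2. A $$ (0, j) * cofactor A 0 j)"
    using assms by (rule laplace_expansion_row) simp
  also have "\<dots> = A $$ (0, 0) * cofactor A 0 0 + A $$ (0, 1) * cofactor A 0 1"
    by (simp add: numeral_2_eq_2)
  finally show ?thesis
    using assms by (simp add: cofactor_def single) (simp add: mat_delete_def)
qed

text \<open>The product \<open>d * e\<close> is both the determinant of the diagonal factor and the
  coefficient of the cross term in the trace; this is what allows minimizing over \<open>D\<close>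
  in closed form.\<close>

lemma objective_corr2_diag2:
  "objective (corr2 c) lam \<alpha> (corr2 r, diag2 d e) =
    - ln (1 - r\<^sup>2) - 2 * (1 - \<alpha>) * ln (d * e) + (d\<^sup>2 + e\<^sup>2 + 2 * c * r * (d * e))
      + 2 * lam * \<bar>r\<bar>"
proof -
  have "det (corr2 r) = 1 - r\<^sup>2"
    by (subst det_mat_2) (auto simp: corr2_def power2_eq_square)
  moreover have "det (diag2 d e) = d * e"
    by (subst det_mat_2) (auto simp: diag2_def)
  moreover have "mat_trace (corr2 c * diag2 d e * corr2 r * diag2 d e)
      = d\<^sup>2 + e\<^sup>2 + 2 * c * r * (d * e)"
    by (simp add: mat_trace_def corr2_def diag2_def scalar_prod_def numeral_2_eq_2
        power2_eq_square algebra_simps)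
  moreover have "{(i, j). i < dim_row (corr2 r) \<and> j < dim_col (corr2 r) \<and> i \<noteq> j} = {(0, 1), (1, 0)}"
    by (auto simp: corr2_def less_2_cases_iff)
  then have "off_diag_l1_norm (corr2 r) = 2 * \<bar>r\<bar>"
    by (simp add: off_diag_l1_norm_def) (simp add: corr2_def)
  ultimately show ?thesis by (simp add: objective_def)
qed

text \<open>Here \<open>s\<close> stands for \<open>- r\<close>, and equality at \<open>s\<close> produces the second minimizer.\<close>

lemma tying_penalty_exists:
  obtains lam s :: real where
    "0 \<le> lam" "0 < s" "s < 1" "18 * ln (1 - 2/3 * s) - ln (1 - s\<^sup>2) + 2 * lam * s = 0"
    "\<And>t. 0 < t \<Longrightarrow> t < 1 \<Longrightarrow> 0 \<le> 18 * ln (1 - 2/3 * t) - ln (1 - t\<^sup>2) + 2 * lam * t"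
proof -
  \<comment> \<open>For t in (0, 1) the required inequality is equivalent to
    \<open>f t \<le> lam\<close>, with a tie exactly when \<open>f t = lam\<close>. It remains to
    show that \<open>f\<close> attains a nonnegative maximum on (0, 1).\<close>
  define f :: "real \<Rightarrow> real" where
    "f t = (ln (1 - t\<^sup>2) - 18 * ln (1 - 2/3 * t)) / (2 * t)" for t
  \<comment> \<open>Beyond \<open>b\<close> the singularity at 1 dominates: \<open>1 - t^2\<close>
    is at most \<open>(1/3)^18\<close>, whereas \<open>1 - 2/3 * t\<close> stays above 1/3, so
    \<open>f\<close> is nonpositive. The exponent 19 leaves one factor 3 to absorb
    \<open>1 + t\<close>.\<close>
  define b :: real where "b = 1 - (1/3)^19"
  have sq: "t\<^sup>2 < 1" if "0 < t" "t < 1" for t :: real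
    using that by (simp add: abs_square_less_1)
  have b: "3/4 \<le> b" "b < 1" by (simp_all add: b_def power_divide)
  have "continuous_on {1/40..b} f"
    unfolding f_def
  proof (intro continuous_intros ballI)
    fix t assume "t \<in> {1/40..b}"
    with b have "0 < t" "t < 1" by auto
    then show "1 - t\<^sup>2 \<noteq> 0" "1 - 2/3 * t \<noteq> 0" "2 * t \<noteq> 0" using sq[of t] by auto
  qed
  then obtain s where s: "s \<in> {1/40..b}" and max: "\<And>t. t \<in> {1/40..b} \<Longrightarrow> f t \<le> f s"
    using continuous_attains_sup[of "{1/40..b}" f] b by auto
  \<comment> \<open>The number 153/25 bounds \<open>f\<close> on (0, 1/40), just above its limit 6
    at 0. Reaching it at 3/4 shows that no larger value hides near 0.\<close>
  have f34: "153/25 \<le> f (3/4)"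
  proof -
    have "ln (16/7 :: real) \<le> 16/7 - 1" by (rule ln_le_minus_one) simp
    moreover have "ln (7/16 :: real) = - ln (16/7)" by (simp add: ln_div)
    moreover have "ln (1/2 :: real) = - ln 2" by (simp add: ln_div)
    moreover have "f (3/4) = (ln (7/16) - 18 * ln (1/2)) / (3/2)"
      by (simp add: f_def power2_eq_square)
    \<comment> \<open>Applying \<open>ln x \<le> x - 1\<close> directly at 1/2 would only give 1/2,
      which is too weak; the splitting 1/2 = 3/4 * 2/3 gives 1/4 + 1/3.\<close>
    moreover have "7/12 \<le> ln (2 :: real)"
    proof -
      have "ln (3/4 :: real) \<le> 3/4 - 1" "ln (2/3 :: real) \<le> 2/3 - 1"
        by (rule ln_le_minus_one; simp)+
      moreover have "ln (1/2 :: real) = ln (3/4) + ln (2/3)" by (subst ln_mult_pos[symmetric]) auto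
      moreover have "ln (1/2 :: real) = - ln 2" by (simp add: ln_div)
      ultimately show ?thesis by simp
    qed
    ultimately show ?thesis by simp
  qed
  have "153/25 \<le> f s" using f34 max[of "3/4"] b by auto
  have le: "f t \<le> f s" if t: "0 < t" "t < 1" for t
  proof -
    consider "t < 1/40" | "t \<in> {1/40..b}" | "b < t" by fastforce
    then show ?thesis
    proof cases
      \<comment> \<open>With x = 2/3 * t the bound is \<open>- ln (1 - x) \<le> x / (1 - x)\<close>.
        For t < 1/40 the denominator exceeds 59/60, and 2/3 * 60/59 < 17/25; finally 18 * 17/25 / 2
        = 153/25.\<close>
      case 1
      have "ln (1 - t\<^sup>2) \<le> 0" using sq[OF t] by simp
      moreover have "- ln (1 - 2/3 * t) \<le> 2/3 * t / (1 - 2/3 * t)"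
      proof -
        have "ln (1 / (1 - 2/3 * t)) \<le> 1 / (1 - 2/3 * t) - 1"
          using t by (intro ln_le_minus_one) simp
        then show ?thesis using t by (simp add: ln_div field_simps)
      qed
      moreover have "2/3 * t / (1 - 2/3 * t) \<le> 17/25 * t"
        using t 1 by (simp add: field_simps)
      ultimately have "ln (1 - t\<^sup>2) - 18 * ln (1 - 2/3 * t) \<le> 153/25 * (2 * t)" by linarith
      then have "f t \<le> 153/25" using t by (simp add: f_def field_simps)
      with \<open>153/25 \<le> f s\<close> show ?thesis by simp
    next
      case 2
      then show ?thesis by (rule max)
    next
      case 3
      have "1 - t\<^sup>2 = (1 - t) * (1 + t)" by (simp add: power2_eq_square algebra_simps)
      also have "\<dots> \<le> (1/3)^19 * 3" using 3 t by (intro mult_mono) (auto simp: b_def)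
      also have "\<dots> = (1/3)^18" by (simp add: power_divide)
      finally have "ln (1 - t\<^sup>2) \<le> ln ((1/3)^18)" using sq[OF t] by (subst ln_le_cancel_iff) auto
      also have "\<dots> = 18 * ln (1/3)" by (subst ln_realpow) auto
      also have "\<dots> \<le> 18 * ln (1 - 2/3 * t)" using t by simp
      finally have "f t \<le> 0" using t by (simp add: f_def divide_le_0_iff)
      with \<open>153/25 \<le> f s\<close> show ?thesis by simp
    qed
  qed
  have s01: "0 < s" "s < 1" using s b by auto
  have f_eq: "f t * (2 * t) = ln (1 - t\<^sup>2) - 18 * ln (1 - 2/3 * t)" if "0 < t" for t
    using that by (simp add: f_def)
  show ?thesis
  proof
    show "0 \<le> f s" using \<open>153/25 \<le> f s\<close> by simp
    show "18 * ln (1 - 2/3 * s) - ln (1 - s\<^sup>2) + 2 * f s * s = 0"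
      using f_eq[of s] s01 by (simp add: algebra_simps)
    fix t :: real assume t: "0 < t" "t < 1"
    have "f t * (2 * t) \<le> f s * (2 * t)" using le[OF t] t by (intro mult_right_mono) auto
    moreover have "f s * (2 * t) = 2 * f s * t" by simp
    ultimately show "0 \<le> 18 * ln (1 - 2/3 * t) - ln (1 - t\<^sup>2) + 2 * f s * t"
      using f_eq[OF t(1)] by linarith
  qed (use s01 in auto)
qed

section \<open>Global lower bound and two points that attain it\<close>

theorem fact1:
  shows "\<exists>p. \<exists>C \<in> correlation_mats p. \<exists>lam \<alpha>. 0 \<le> lam \<and> \<alpha> < 1 \<and>
    (\<exists>x \<in> minimizers p C lam \<alpha>. \<exists>y \<in> minimizers p C lam \<alpha>. x \<noteq> y)"
proof -
  obtain lam s :: real where lam: "0 \<le> lam" and s: "0 < s" "s < 1"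
    and tie: "18 * ln (1 - 2/3 * s) - ln (1 - s\<^sup>2) + 2 * lam * s = 0"
    and nonneg: "\<And>t. 0 < t \<Longrightarrow> t < 1 \<Longrightarrow> 0 \<le> 18 * ln (1 - 2/3 * t) - ln (1 - t\<^sup>2) + 2 * lam * t"
    by (rule tying_penalty_exists) (rule that)
  \<comment> \<open>The value at r = 0 and d = e = 3, the optimal scaling of the identity.\<close>
  define v :: real where "v = 18 - 18 * ln 9"
  define obj where "obj = objective (corr2 (2/3)) lam (- 8)"
  have obj: "obj (corr2 r, diag2 d e) = - ln (1 - r\<^sup>2) - 18 * ln (d * e)
      + (d\<^sup>2 + e\<^sup>2 + 4/3 * r * (d * e)) + 2 * lam * \<bar>r\<bar>" for r d e
    by (simp add: obj_def objective_corr2_diag2)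
  have lower: "v \<le> obj RD" if "RD \<in> pos_def_unit_diag_mats 2 \<times> pos_diag_mats 2" for RD
  proof -
    obtain r d e where RD: "RD = (corr2 r, diag2 d e)" and r: "\<bar>r\<bar> < 1" and de: "0 < d" "0 < e"
      using \<open>RD \<in> _\<close> by (auto elim!: pos_def_unit_diag_mats_2E pos_diag_mats_2E)
    define q where "q = 1 + 2/3 * r"
    have q: "0 < q" using r by (simp add: q_def)
    \<comment> \<open>The trace is at least \<open>2 * (d * e * q)\<close>, with equality for d = e.
      Then \<open>ln x \<le> x - 1\<close> at \<open>x = d * e * q / 9\<close>, sharp when
      \<open>d * e * q = 9\<close>, removes \<open>d\<close> and \<open>e\<close>: the objective
      exceeds \<open>v\<close> by at least a function of \<open>r\<close> alone.\<close>
    have "0 \<le> (d - e)\<^sup>2" by simp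
    then have amgm: "2 * (d * e) \<le> d\<^sup>2 + e\<^sup>2" by (simp add: power2_eq_square algebra_simps)
    have "ln (d * e * q / 9) \<le> d * e * q / 9 - 1" using de q by (intro ln_le_minus_one) simp
    moreover have "ln (d * e * q / 9) = ln (d * e) + ln q - ln 9"
      using de q by (simp add: ln_div ln_mult)
    moreover have "d * e * q = d * e + 2/3 * r * (d * e)" by (simp add: q_def algebra_simps)
    moreover have "0 \<le> 18 * ln q - ln (1 - r\<^sup>2) + 2 * lam * \<bar>r\<bar>"
    proof (cases "r < 0")
      case True
      then show ?thesis using nonneg[of "- r"] r by (simp add: q_def)
    next
      case False
      then have "0 \<le> ln q" by (simp add: q_def)
      moreover have "r\<^sup>2 < 1" using r by (simp add: abs_square_less_1)
      then have "ln (1 - r\<^sup>2) \<le> 0" by simp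
      moreover have "0 \<le> 2 * lam * \<bar>r\<bar>" using lam by simp
      ultimately show ?thesis by linarith
    qed
    ultimately show ?thesis unfolding RD obj v_def using amgm by linarith
  qed
  have minim: "RD \<in> minimizers 2 (corr2 (2/3)) lam (- 8)"
    if "RD \<in> pos_def_unit_diag_mats 2 \<times> pos_diag_mats 2" "obj RD = v" for RD
    using that lower by (auto simp: minimizers_def is_arg_min_def obj_def[symmetric] not_less)
  \<comment> \<open>Both inequalities in the lower bound are equalities when d = e and
    \<open>d * d * q = 9\<close>, where \<open>q = 1 - 2/3 * s\<close> for r = -s.\<close>
  define d where "d = sqrt (9 / (1 - 2/3 * s))"
  have d: "0 < d" and dd: "d * d = 9 / (1 - 2/3 * s)" using s by (simp_all add: d_def)
  have d2: "d\<^sup>2 + d\<^sup>2 + 4/3 * (- s) * (d * d) = 18"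
  proof -
    have "d\<^sup>2 + d\<^sup>2 + 4/3 * (- s) * (d * d) = 2 * (1 - 2/3 * s) * (d * d)"
      by (simp add: power2_eq_square algebra_simps)
    also have "\<dots> = 18" unfolding dd using s by (simp add: field_simps)
    finally show ?thesis .
  qed
  have "ln (d * d) = ln 9 - ln (1 - 2/3 * s)" unfolding dd using s by (simp add: ln_div)
  then have "obj (corr2 (- s), diag2 d d) = v"
    unfolding obj d2 v_def using tie s by simp
  then have y: "(corr2 (- s), diag2 d d) \<in> minimizers 2 (corr2 (2/3)) lam (- 8)"
    using s d by (intro minim) (auto intro: corr2_in_pos_def_unit_diag_mats diag2_in_pos_diag_mats)
  have x: "(corr2 0, diag2 3 3) \<in> minimizers 2 (corr2 (2/3)) lam (- 8)"
    by (intro minim)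
      (auto intro: corr2_in_pos_def_unit_diag_mats diag2_in_pos_diag_mats simp: obj v_def)
  have "corr2 0 $$ (0, 1) \<noteq> corr2 (- s) $$ (0, 1)" using s by (simp add: corr2_def)
  then have "(corr2 0, diag2 3 3) \<noteq> (corr2 (- s), diag2 d d)" by auto
  moreover have "corr2 (2/3) \<in> correlation_mats 2" by (rule corr2_in_correlation_mats) simp
  moreover have "(- 8 :: real) < 1" by simp
  ultimately show ?thesis using x y lam by blast
qed

end
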